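(* Let $\bm\lambda\in\mathbb{R}^s$ and $\bm\gamma_1=\bm\gamma_0+\bm\lambda/\sqrt n$, $n\in\mathbb{N}$. Assume that there exist $r>0$ and finite constants $M_1,M_2$ such that $h(\bm x;\bm\gamma)$ is twice continuously differentiable with respect to $\bm\gamma\in\mathcal B(\bm\gamma_0,r)$ for all $\bm x\in\mathcal X$, and $$\sup_{\bm x\in\mathcal X}\|\nabla h(\bm x;\bm\gamma_0)\|\le M_1<\infty,\qquad \sup_{\bm x\in\mathcal X}\ \sup_{\bm\gamma\in\mathcal B(\bm\gamma_0,r)}\|h''(\bm x;\bm\gamma)\|_2\le M_2<\infty .$$ Assume also that $\underline{\bm x}=\arg\inf_{\bm x\in\mathcal X}h(\bm x;\bm\gamma_1)$ and $\overline{\bm x}=\arg\sup_{\bm x\in\mathcal X}h(\bm x;\bm\gamma_1)$ do not depend on $\bm\gamma_1$, and that $\sup_{\bm x\in\mathcal X}h(\bm x;\bm\gamma_1)/\inf_{\bm x\in\mathcal X}h(\bm x;\bm\gamma_1)\to1$ as $\bm\gamma_1\to\bm\gamma_0$. Then the limiting KL-optimal design $$\xi^{KL}_{\bm\gamma_0}=\left\{\begin{array}{cc}\underline{\bm x}&\overline{\bm x}\\0.5&0.5\end{array}\right\}$$ maximizes the noncentrality parameter $\zeta(\xi;\bm\lambda;\bm\gamma_0)$ over all designs $\xi\in\Xi$.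
   Context: Setting. $\mathcal X\subseteq\mathbb{R}^p$ is compact; a design $\xi$ is a discrete (finitely supported) probability measure on $\mathcal X$ with support points $\bm x_1,\dots,\bm x_k$ and weights $\xi(\bm x_i)$; $\Xi$ is the set of all designs. $h:\mathbb{R}^p\times\mathbb{R}^s\to\mathbb{R}_+$ is a continuous positive function, and $\bm\gamma_0\in\mathbb{R}^s$ is such that $h(\bm x;\bm\gamma_0)=1$ for all $\bm x$. $\nabla h$ and $h''$ are the gradient and Hessian of $h$ with respect to $\bm\gamma$; $\mathcal B(\bm\gamma_0,r)$ is the ball of radius $r$ centred at $\bm\gamma_0$; $\|\cdot\|$ is the Euclidean norm and $\|\cdot\|_2$ the spectral norm. "Do not depend on $\bm\gamma_1$" means that fixed points $\underline{\bm x},\overline{\bm x}\in\mathcal X$ are respectively a minimizer and a maximizer of $h(\cdot;\bm\gamma_0+\bm\lambda/\sqrt n)$ over $\mathcal X$ for every $n$; the limit $\bm\gamma_1\to\bm\gamma_0$ is as $n\to\infty$. The design $\xi^{KL}_{\bm\gamma_0}$ puts weight $1/2$ on each of $\underline{\bm x},\overline{\bm x}$. Noncentrality parameter (of the asymptotic chi-squared distribution of a likelihood-based test of $\bm\gamma=\bm\gamma_0$ against $\bm\gamma=\bm\gamma_0+\bm\lambda/\sqrt n$): $$\zeta(\xi;\bm\lambda;\bm\gamma_0)=\frac12\bm\lambda^T\left(\sum_{i=1}^k\nabla h(\bm x_i;\bm\gamma_0)\nabla h(\bm x_i;\bm\gamma_0)^T\xi(\bm x_i)-\sum_{i=1}^k\nabla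 h(\bm x_i;\bm\gamma_0)\xi(\bm x_i)\sum_{i=1}^k\nabla h(\bm x_i;\bm\gamma_0)^T\xi(\bm x_i)\right)\bm\lambda .$$ *)

theory Defs
  imports "HOL-Probability.Probability"
begin

definition gradient :: "('a::real_inner \<Rightarrow> real) \<Rightarrow> 'a \<Rightarrow> 'a" where
  "gradient f y = (THE D. GDERIV f y :> D)"

definition hessian :: "(real^'s \<Rightarrow> real) \<Rightarrow> real^'s \<Rightarrow> real^'s^'s" where
  "hessian f y = jacobian (gradient f) (at y)"

(* Intended for open S; there, two-sided differentiability of f and of its gradient together
   with continuity of the Hessian is the usual notion of class C^2. *)
definition twice_cont_diff_on :: "(real^'s) set \<Rightarrow> (real^'s \<Rightarrow> real) \<Rightarrow> bool" where
  "twice_cont_diff_on S f \<longleftrightarrow>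
     (\<forall>y\<in>S. f differentiable (at y)) \<and>
     (\<forall>y\<in>S. gradient f differentiable (at y)) \<and>
     continuous_on S (hessian f)"

(* The operator norm induced by the Euclidean norm, i.e. the largest singular value. *)
definition spectral_norm :: "real^'n^'m \<Rightarrow> real" where
  "spectral_norm A = onorm (\<lambda>v. A *v v)"

definition designs :: "'x set \<Rightarrow> 'x pmf set" where
  "designs X = {\<xi>. finite (set_pmf \<xi>) \<and> set_pmf \<xi> \<subseteq> X}"

(* If xlo = xup, the two weights add up and this is the one-point design. *)
definition kl_design :: "'x \<Rightarrow> 'x \<Rightarrow> 'x pmf" where
  "kl_design xlo xup = pmf_of_list [(xlo, 1/2), (xup, 1/2)]"

definition local_alternative :: "real^'s \<Rightarrow> real^'s \<Rightarrow> nat \<Rightarrow> real^'s" where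
  "local_alternative \<gamma>0 lam n = \<gamma>0 + (1 / sqrt (real n)) *\<^sub>R lam"

definition outer_product :: "real^'s \<Rightarrow> real^'s \<Rightarrow> real^'s^'s" where
  "outer_product v w = (columnvector v :: real^1^'s) ** (rowvector w :: real^'s^1)"

definition noncentrality ::
  "('x \<Rightarrow> real^'s \<Rightarrow> real) \<Rightarrow> 'x pmf \<Rightarrow> real^'s \<Rightarrow> real^'s \<Rightarrow> real" where
  "noncentrality h \<xi> lam \<gamma>0 =
     (let g = (\<lambda>x. gradient (h x) \<gamma>0);
          m = (\<Sum>x\<in>set_pmf \<xi>. pmf \<xi> x *\<^sub>R g x)
      in 1/2 * (lam \<bullet> (((\<Sum>x\<in>set_pmf \<xi>. pmf \<xi> x *\<^sub>R outer_product (g x) (g x))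
                      - outer_product m m) *v lam)))"

end

theory Submission
  imports Defs "HOL-Real_Asymp.Real_Asymp"
begin

text \<open>Only the scalar scores \<open>a x = lam \<bullet> gradient (h x) \<gamma>0\<close> matter: the noncentrality
  parameter is half the variance of \<open>a\<close> under the design. As \<open>a x\<close> is the limit of the difference
  quotients of \<open>h x\<close> along the local alternatives, the points minimizing and maximizing \<open>h\<close> at all
  the alternatives also minimize and maximize \<open>a\<close>. By Popoviciu's inequality the variance of a
  function with values in \<open>[lo, up]\<close> is at most \<open>((up - lo) / 2)\<^sup>2\<close>, and the two-point design with
  equal weights at the extremal points attains this bound.\<close>

lemma GDERIV_unique:
  assumes "GDERIV f y :> D" and "GDERIV f y :> E"
  shows "D = E"
proof -
  have "(\<lambda>v. v \<bullet> D) = (\<lambda>v. v \<bullet> E)"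
    using assms unfolding gderiv_def by (rule has_derivative_unique)
  then have "(D - E) \<bullet> D = (D - E) \<bullet> E" by meson
  then have "(D - E) \<bullet> (D - E) = 0" by (simp add: inner_diff_right)
  then show ?thesis by simp
qed

text \<open>The derivative is a linear functional, so it is the inner product with its Riesz vector
  \<open>adjoint f' 1\<close>. With uniqueness, this makes the description behind
  \<open>gradient\<close> well defined.\<close>

lemma GDERIV_gradient:
  fixes f :: "'a::euclidean_space \<Rightarrow> real"
  assumes "f differentiable (at y)"
  shows "GDERIV f y :> gradient f y"
proof -
  obtain f' where f': "(f has_derivative f') (at y)"
    using assms by (auto simp: differentiable_def)
  then have "linear f'" by (rule has_derivative_linear)
  then have "f' = (\<lambda>v. v \<bullet> adjoint f' 1)" by (auto simp: adjoint_works)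
  with f' have grad: "GDERIV f y :> adjoint f' 1" by (simp add: gderiv_def)
  show ?thesis
    unfolding gradient_def using grad by (rule theI) (rule GDERIV_unique[OF _ grad])
qed

lemma difference_quotient_local_alternative:
  fixes f :: "real^'s \<Rightarrow> real"
  assumes "f differentiable (at y)"
  shows "(\<lambda>n. sqrt (real n) * (f (local_alternative y lam n) - f y))
           \<longlonglongrightarrow> lam \<bullet> gradient f y"
proof -
  \<comment> \<open>The base point is written as the value at \<open>t = 0\<close> of the line
    \<open>y + t *\<^sub>R lam\<close>, ready for the chain rule.\<close>
  have "(f has_derivative (\<lambda>v. v \<bullet> gradient f y)) (at (y + 0 *\<^sub>R lam))"
    using GDERIV_gradient[OF assms] by (simp add: gderiv_def)
  moreover have "((\<lambda>t::real. y + t *\<^sub>R lam) has_derivative (\<lambda>t. t *\<^sub>R lam)) (at 0)"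
    by (auto intro!: derivative_eq_intros)
  ultimately have "((\<lambda>t. f (y + t *\<^sub>R lam)) has_derivative (\<lambda>t. (t *\<^sub>R lam) \<bullet> gradient f y)) (at 0)"
    using has_derivative_compose by blast
  then have "((\<lambda>t. f (y + t *\<^sub>R lam)) has_field_derivative lam \<bullet> gradient f y) (at 0)"
    by (simp add: has_field_derivative_def mult.commute[of _ "lam \<bullet> _"])
  then have quotient: "((\<lambda>t. (f (y + t *\<^sub>R lam) - f y) / t) \<longlongrightarrow> lam \<bullet> gradient f y) (at 0)"
    by (simp add: has_field_derivative_iff)
  have "filterlim (\<lambda>n. 1 / sqrt (real n)) (at 0) sequentially"
  proof (rule filterlim_atI)
    show "(\<lambda>n. 1 / sqrt (real n)) \<longlonglongrightarrow> 0" by real_asymp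
    \<comment> \<open>Only from \<open>n = 1\<close> on: at \<open>n = 0\<close> division by zero
      gives the value 0.\<close>
    show "\<forall>\<^sub>F n in sequentially. 1 / sqrt (real n) \<noteq> 0" by (auto intro: eventually_sequentiallyI[of 1])
  qed
  from filterlim_compose[OF quotient this] show ?thesis
    by (simp add: local_alternative_def mult.commute)
qed

text \<open>Since \<open>f y = g y\<close>, the order of the values passes to the scaled increments,
  and then to their limits, the directional derivatives along \<open>lam\<close>.\<close>

lemma gradient_mono_of_local_alternatives:
  fixes f g :: "real^'s \<Rightarrow> real"
  assumes "f differentiable (at y)" and "g differentiable (at y)" and "f y = g y"
    and le: "\<And>n. n \<ge> 1 \<Longrightarrow> f (local_alternative y lam n) \<le> g (local_alternative y lam n)"
  shows "lam \<bullet> gradient f y \<le> lam \<bullet> gradient g y"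
proof (rule LIMSEQ_le)
  show "\<exists>N. \<forall>n\<ge>N. sqrt (real n) * (f (local_alternative y lam n) - f y)
                 \<le> sqrt (real n) * (g (local_alternative y lam n) - g y)"
    using le \<open>f y = g y\<close> by (intro exI[of _ 1]) (auto intro!: mult_left_mono)
qed (rule difference_quotient_local_alternative assms)+

lemma outer_product_mult_vec: "outer_product v w *v u = (w \<bullet> u) *\<^sub>R v"
  by (simp add: vec_eq_iff outer_product_def columnvector_def rowvector_def
      matrix_matrix_mult_def matrix_vector_mult_def inner_vec_def sum_distrib_left mult_ac)

text \<open>The quadratic form of a rank-one matrix \<open>outer_product v v\<close> at
  \<open>lam\<close> is the square of \<open>lam \<bullet> v\<close>; apply this to each gradient
  and to their mean.\<close>

lemma noncentrality_eq_variance: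
  "noncentrality h \<xi> lam \<gamma>0 =
     1/2 * ((\<Sum>x\<in>set_pmf \<xi>. pmf \<xi> x * (lam \<bullet> gradient (h x) \<gamma>0)\<^sup>2)
            - (\<Sum>x\<in>set_pmf \<xi>. pmf \<xi> x * (lam \<bullet> gradient (h x) \<gamma>0))\<^sup>2)"
proof -
  have sum_mult_vec: "(\<Sum>x\<in>A. c x *\<^sub>R M x) *v lam = (\<Sum>x\<in>A. c x *\<^sub>R (M x *v lam))"
    for A :: "'a set" and c and M :: "'a \<Rightarrow> real^'b^'b"
    by (induction A rule: infinite_finite_induct)
       (auto simp: matrix_vector_mult_add_rdistrib scaleR_matrix_vector_assoc)
  show ?thesis
    by (simp add: noncentrality_def Let_def matrix_vector_mult_diff_rdistrib inner_diff_right
        sum_mult_vec outer_product_mult_vec inner_sum_right inner_sum_left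
        inner_commute[of _ lam] power2_eq_square mult.assoc)
qed

text \<open>Averaging \<open>(a x - lo) * (up - a x) \<ge> 0\<close> bounds the second moment
  linearly in the mean \<open>m\<close>; completing the square in \<open>m\<close> then gives the
  bound.\<close>

lemma variance_le_Popoviciu:
  fixes w a :: "'x \<Rightarrow> real"
  assumes "\<And>x. x \<in> S \<Longrightarrow> w x \<ge> 0" and "sum w S = 1"
    and "\<And>x. x \<in> S \<Longrightarrow> lo \<le> a x" and "\<And>x. x \<in> S \<Longrightarrow> a x \<le> up"
  shows "(\<Sum>x\<in>S. w x * (a x)\<^sup>2) - (\<Sum>x\<in>S. w x * a x)\<^sup>2 \<le> ((up - lo) / 2)\<^sup>2"
proof -
  define m where "m = (\<Sum>x\<in>S. w x * a x)"
  have "0 \<le> (\<Sum>x\<in>S. w x * ((a x - lo) * (up - a x)))"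
    using assms by (intro sum_nonneg mult_nonneg_nonneg) auto
  also have "\<dots> = (\<Sum>x\<in>S. (lo + up) * (w x * a x) - lo * up * w x - w x * (a x)\<^sup>2)"
    by (intro sum.cong) (auto simp: algebra_simps power2_eq_square)
  also have "\<dots> = (lo + up) * m - lo * up - (\<Sum>x\<in>S. w x * (a x)\<^sup>2)"
    by (simp add: sum_subtractf m_def assms(2) flip: sum_distrib_left)
  finally have "(\<Sum>x\<in>S. w x * (a x)\<^sup>2) - m\<^sup>2 \<le> (lo + up) * m - lo * up - m\<^sup>2" by simp
  also have "\<dots> = ((up - lo) / 2)\<^sup>2 - (m - (lo + up) / 2)\<^sup>2"
    by (simp add: power2_eq_square field_simps)
  finally show ?thesis
    using zero_le_power2[of "m - (lo + up) / 2"] unfolding m_def by linarith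
qed

lemma pmf_of_list_wf_kl: "pmf_of_list_wf [(xlo, 1/2), (xup, 1/2 :: real)]"
  by (simp add: pmf_of_list_wf_def)

lemma set_pmf_kl_design: "set_pmf (kl_design xlo xup) = {xlo, xup}"
  unfolding kl_design_def by (subst set_pmf_of_list_eq[OF pmf_of_list_wf_kl]) auto

lemma sum_kl_design:
  fixes f :: "'x \<Rightarrow> real"
  shows "(\<Sum>x\<in>set_pmf (kl_design xlo xup). pmf (kl_design xlo xup) x * f x) = (f xlo + f xup) / 2"
  unfolding set_pmf_kl_design
  \<comment> \<open>If the points coincide, the sum has a single term of weight 1, which still
    equals the average.\<close>
  by (cases "xlo = xup") (auto simp: kl_design_def pmf_pmf_of_list[OF pmf_of_list_wf_kl])

text \<open>The equality case of Popoviciu: \<open>(u\<^sup>2 + v\<^sup>2) / 2 - ((u + v) /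
  2)\<^sup>2 = ((u - v) / 2)\<^sup>2\<close>.\<close>

lemma noncentrality_kl_design:
  "noncentrality h (kl_design xlo xup) lam \<gamma>0 =
     1/2 * ((lam \<bullet> gradient (h xup) \<gamma>0 - lam \<bullet> gradient (h xlo) \<gamma>0) / 2)\<^sup>2"
  unfolding noncentrality_eq_variance sum_kl_design by (simp add: power2_eq_square field_simps)

theorem corollary2:
  fixes X :: "(real^'p) set"
    and h :: "real^'p \<Rightarrow> real^'s \<Rightarrow> real"
    and \<gamma>0 lam :: "real^'s"
    and xlo xup :: "real^'p"
    and r M1 M2 :: real
  assumes "compact X"
    and "continuous_on UNIV (\<lambda>(x, \<gamma>). h x \<gamma>)"
    and "\<forall>x \<gamma>. h x \<gamma> > 0"
    and "\<forall>x. h x \<gamma>0 = 1"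
    and "r > 0"
    and "\<forall>x\<in>X. twice_cont_diff_on (ball \<gamma>0 r) (h x)"
    and "\<forall>x\<in>X. norm (gradient (h x) \<gamma>0) \<le> M1"
    and "\<forall>x\<in>X. \<forall>\<gamma>\<in>ball \<gamma>0 r. spectral_norm (hessian (h x) \<gamma>) \<le> M2"
    and "\<forall>n\<ge>1. is_arg_min (\<lambda>x. h x (local_alternative \<gamma>0 lam n)) (\<lambda>x. x \<in> X) xlo"
    and "\<forall>n\<ge>1. is_arg_max (\<lambda>x. h x (local_alternative \<gamma>0 lam n)) (\<lambda>x. x \<in> X) xup"
    and "(\<lambda>n. (SUP x\<in>X. h x (local_alternative \<gamma>0 lam n))
              / (INF x\<in>X. h x (local_alternative \<gamma>0 lam n))) \<longlonglongrightarrow> 1"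
  shows "is_arg_max (\<lambda>\<xi>. noncentrality h \<xi> lam \<gamma>0) (\<lambda>\<xi>. \<xi> \<in> designs X) (kl_design xlo xup)"
proof -
  have lo: "xlo \<in> X" and up: "xup \<in> X"
    using assms(9,10) by (auto simp: is_arg_min_def is_arg_max_def)
  define a where "a x = lam \<bullet> gradient (h x) \<gamma>0" for x
  have diff: "h x differentiable (at \<gamma>0)" if "x \<in> X" for x
    using assms(5,6) that by (auto simp: twice_cont_diff_on_def)
  \<comment> \<open>The functions compared are \<open>h xlo\<close>, \<open>h x\<close> and
    \<open>h xup\<close>; their common value at \<open>\<gamma>0\<close> is 1.\<close>
  have a_lo: "a xlo \<le> a x" and a_up: "a x \<le> a xup" if "x \<in> X" for x
    using assms(4,9,10) that lo up unfolding a_def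
    by (auto intro!: gradient_mono_of_local_alternatives diff
        simp: is_arg_min_def is_arg_max_def not_less)
  have "noncentrality h \<xi> lam \<gamma>0 \<le> noncentrality h (kl_design xlo xup) lam \<gamma>0"
    if "\<xi> \<in> designs X" for \<xi>
  proof -
    have "(\<Sum>x\<in>set_pmf \<xi>. pmf \<xi> x * (a x)\<^sup>2) - (\<Sum>x\<in>set_pmf \<xi>. pmf \<xi> x * a x)\<^sup>2
            \<le> ((a xup - a xlo) / 2)\<^sup>2"
      using that a_lo a_up
      by (intro variance_le_Popoviciu) (auto simp: designs_def intro: sum_pmf_eq_1)
    then show ?thesis
      unfolding noncentrality_kl_design by (simp add: noncentrality_eq_variance a_def)
  qed
  moreover have "kl_design xlo xup \<in> designs X"
    using lo up by (auto simp: designs_def set_pmf_kl_design)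
  ultimately show ?thesis by (auto simp: is_arg_max_def not_less)
qed

end
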